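(* Let $B\ge 2$ be an integer. Consider single-agent ski rental with varying prices in the "anything goes" case, where the agent has a perfect self-predictor, i.e. the number of active days $T=\widehat T\ge 1$ is known to the algorithm in advance. The following are true. 1. Suppose $\widehat T\le B$. Then no deterministic online algorithm can be better than $\widehat T$-competitive. Algorithms with thresholds $\theta_1(\widehat T)=0$, $\theta_2(\widehat T)\le\widehat T-2$, $\theta_3(\widehat T)\le\widehat T-3$, $\ldots$, $\theta_{\widehat T}(\widehat T)=0$ (that is, $\theta_1(\widehat T)=0$ and $\theta_j(\widehat T)\le\widehat T-j$ for $2\le j\le\widehat T$) are the only $\widehat T$-competitive ones. 2. Suppose $\widehat T=B+1$. Then the optimal algorithms are the ones with thresholds $\theta_1(\widehat T)=0$, $\theta_2(\widehat T)\le B$, $\theta_3(\widehat T)\le B-1$, $\ldots$, $\theta_{B+1}(\widehat T)\le 1$. They are $(B+1)$-competitive. 3. Suppose $\widehat T>B+1$. Then the only optimal algorithm is the one with $\theta_1(\widehat T)=0$, $\theta_2(\widehat T)=B$ (the same as the optimal algorithm without predictions); it is $(B+1)$-competitive. In particular, no algorithm with perfect self-predictions can be better than $(B+1)$-competitive, which is the same competitive ratio as that of algorithms with no or pessimal self-predictions.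
   Context: An agent needs a resource on days $1,\dots,\widehat T$, with $\widehat T$ known. The prices $p_1,p_2,\dots$ are integers in $\{0,\dots,B\}$ chosen adversarially and not known in advance. For given $\widehat T$, a deterministic (non-adaptive) online algorithm is a sequence of integer thresholds $\theta_1(\widehat T),\dots,\theta_{\widehat T}(\widehat T)\in\{0,\dots,B\}$. On day $i$ (if it has not bought yet): if $p_i\le\theta_i(\widehat T)$ the agent buys, paying $\theta_i(\widehat T)$ (the full threshold, even if $p_i<\theta_i(\widehat T)$; if $p_i=0=\theta_i(\widehat T)$ the resource is obtained for free), and pays nothing afterwards; otherwise it rents that day at cost $1$. So if $j$ is the first day with $p_j\le\theta_j(\widehat T)$ the cost is $j-1+\theta_j(\widehat T)$ if $j\le\widehat T$, and it is $\widehat T$ if there is no such $j\le\widehat T$. The offline optimum has cost $\min\bigl(\widehat T,\min_{1\le i\le\widehat T}(i-1+p_i)\bigr)$. An online algorithm $A$ is $\gamma$-competitive if there exists a constant $d$ (which may depend on $\gamma$, but not on the input $x$) such that $cost(A(x))\le\gamma\cdot cost(OPT(x))+d$ for all inputs $x$. In items 1–3 the value $\widehat T=T$ is fixed and the inputs are the price sequences $p$; in the final sentence the inputs are the pairs $(p,T)$, with $\widehat T=T$. An algorithm is optimal (for a given $\widehat T$) if it is $\gamma$-competitive for the best possible $\gamma$ among deterministic online algorithms. Since a day with threshold $B$ always results in buying, thresholds following the first threshold equal to $B$ are never used, and algorithms differing only in such thresholds are identified.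
   Formalization: Competitive is taken with d = 0 (with d allowed, every algorithm is 0-competitive for fixed T), and in item 1 the only T-competitive algorithms are those with θ_1 = 0, θ_j ≤ T+1−j instead of T−j (for B = T = 2, thresholds (0,1) are 2-competitive). *)

theory Defs
  imports Complex_Main
begin

text \<open>Days are numbered from 1; the values of price and threshold sequences at 0 are never used.\<close>

definition prices :: "nat \<Rightarrow> (nat \<Rightarrow> nat) set" where
  "prices B = {p. \<forall>i\<ge>1. p i \<le> B}"

text \<open>The set \<open>D\<close> of days on which thresholds are given is \<open>{1..T}\<close> for a known horizon \<open>T\<close>
  and \<open>{1..}\<close> when the number of active days cannot be relied upon.\<close>

definition threshold_algs :: "nat \<Rightarrow> nat set \<Rightarrow> (nat \<Rightarrow> nat) set" where
  "threshold_algs B D = {\<theta>. \<forall>i\<in>D. \<theta> i \<le> B}"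

definition buys_within :: "(nat \<Rightarrow> nat) \<Rightarrow> nat \<Rightarrow> (nat \<Rightarrow> nat) \<Rightarrow> bool" where
  "buys_within \<theta> T p \<longleftrightarrow> (\<exists>j\<in>{1..T}. p j \<le> \<theta> j)"

definition buying_day :: "(nat \<Rightarrow> nat) \<Rightarrow> nat \<Rightarrow> (nat \<Rightarrow> nat) \<Rightarrow> nat" where
  "buying_day \<theta> T p = (LEAST j. j \<in> {1..T} \<and> p j \<le> \<theta> j)"

text \<open>The buyer pays the threshold, not the price.\<close>

definition alg_cost :: "(nat \<Rightarrow> nat) \<Rightarrow> nat \<Rightarrow> (nat \<Rightarrow> nat) \<Rightarrow> nat" where
  "alg_cost \<theta> T p =
     (if buys_within \<theta> T p
      then buying_day \<theta> T p - 1 + \<theta> (buying_day \<theta> T p)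
      else T)"

text \<open>Used only for \<open>T \<ge> 1\<close>, where the inner minimum ranges over a nonempty set.\<close>

definition opt_cost :: "nat \<Rightarrow> (nat \<Rightarrow> nat) \<Rightarrow> nat" where
  "opt_cost T p = min T (Min ((\<lambda>i. i - 1 + p i) ` {1..T}))"

text \<open>
  Competitiveness is taken without an additive constant. For fixed \<open>B\<close> the offline cost is at
  most \<open>p 1 \<le> B\<close>, and for fixed \<open>T\<close> every online cost is at most \<open>T + B\<close>. If an additive
  constant were allowed, every algorithm would therefore be \<open>\<gamma>\<close>-competitive for every \<open>\<gamma>\<close> on a
  fixed horizon, and buying on the first day at threshold \<open>B\<close> would be 0-competitive over all
  horizons.
\<close>

definition competitive :: "'x set \<Rightarrow> ('x \<Rightarrow> nat) \<Rightarrow> ('x \<Rightarrow> nat) \<Rightarrow> real \<Rightarrow> bool" where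
  "competitive X cost opt \<gamma> \<longleftrightarrow> (\<forall>x\<in>X. real (cost x) \<le> \<gamma> * real (opt x))"

definition best_ratio :: "'a set \<Rightarrow> ('a \<Rightarrow> real \<Rightarrow> bool) \<Rightarrow> real \<Rightarrow> bool" where
  "best_ratio A cmp \<gamma> \<longleftrightarrow>
     (\<exists>a\<in>A. cmp a \<gamma>) \<and> (\<forall>a\<in>A. \<forall>\<gamma>'. cmp a \<gamma>' \<longrightarrow> \<gamma> \<le> \<gamma>')"

definition optimal :: "'a set \<Rightarrow> ('a \<Rightarrow> real \<Rightarrow> bool) \<Rightarrow> 'a \<Rightarrow> bool" where
  "optimal A cmp a \<longleftrightarrow> a \<in> A \<and> (\<exists>\<gamma>. best_ratio A cmp \<gamma> \<and> cmp a \<gamma>)"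

text \<open>The number \<open>T\<close> of active days is fixed and known; inputs are price sequences.\<close>

definition competitive_known :: "nat \<Rightarrow> nat \<Rightarrow> (nat \<Rightarrow> nat) \<Rightarrow> real \<Rightarrow> bool" where
  "competitive_known B T \<theta> = competitive (prices B) (alg_cost \<theta> T) (opt_cost T)"

text \<open>
  An algorithm with a self-predictor is a family \<open>\<Theta>\<close> of threshold sequences indexed by the
  prediction. Under perfect predictions the inputs are pairs of prices and active days, the latter
  being also the prediction.
\<close>

definition perfect_algs :: "nat \<Rightarrow> (nat \<Rightarrow> nat \<Rightarrow> nat) set" where
  "perfect_algs B = {\<Theta>. \<forall>T\<ge>1. \<Theta> T \<in> threshold_algs B {1..T}}"

definition competitive_perfect :: "nat \<Rightarrow> (nat \<Rightarrow> nat \<Rightarrow> nat) \<Rightarrow> real \<Rightarrow> bool" where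
  "competitive_perfect B \<Theta> =
     competitive (prices B \<times> {1..}) (\<lambda>(p, T). alg_cost (\<Theta> T) T p) (\<lambda>(p, T). opt_cost T p)"

definition competitive_no_prediction :: "nat \<Rightarrow> (nat \<Rightarrow> nat) \<Rightarrow> real \<Rightarrow> bool" where
  "competitive_no_prediction B \<theta> =
     competitive (prices B \<times> {1..}) (\<lambda>(p, T). alg_cost \<theta> T p) (\<lambda>(p, T). opt_cost T p)"

text \<open>
  Under pessimal predictions the prediction \<open>P\<close> is unrelated to the number \<open>T\<close> of active days and
  chosen by the adversary. As \<open>T > P\<close> is possible, thresholds are needed on all days.
\<close>

definition pessimal_algs :: "nat \<Rightarrow> (nat \<Rightarrow> nat \<Rightarrow> nat) set" where
  "pessimal_algs B = {\<Theta>. \<forall>P\<ge>1. \<Theta> P \<in> threshold_algs B {1..}}"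

definition competitive_pessimal :: "nat \<Rightarrow> (nat \<Rightarrow> nat \<Rightarrow> nat) \<Rightarrow> real \<Rightarrow> bool" where
  "competitive_pessimal B \<Theta> =
     competitive (prices B \<times> {1..} \<times> {1..})
       (\<lambda>(p, T, P). alg_cost (\<Theta> P) T p) (\<lambda>(p, T, P). opt_cost T p)"

text \<open>
  A threshold \<open>B\<close> always leads to buying, so later thresholds are never used. Two algorithms are
  identified if they agree on all days up to and including the first one with threshold \<open>B\<close>.
\<close>

definition identified :: "nat \<Rightarrow> nat set \<Rightarrow> (nat \<Rightarrow> nat) \<Rightarrow> (nat \<Rightarrow> nat) \<Rightarrow> bool" where
  "identified B D \<theta> \<theta>' \<longleftrightarrow>
     (\<forall>i\<in>D. (\<forall>j\<in>D. j < i \<longrightarrow> \<theta> j \<noteq> B) \<longrightarrow> \<theta> i = \<theta>' i)"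

definition up_to_identification ::
    "nat \<Rightarrow> nat set \<Rightarrow> ((nat \<Rightarrow> nat) \<Rightarrow> bool) \<Rightarrow> (nat \<Rightarrow> nat) \<Rightarrow> bool" where
  "up_to_identification B D Q \<theta> \<longleftrightarrow>
     (\<exists>\<theta>'\<in>threshold_algs B D. identified B D \<theta> \<theta>' \<and> Q \<theta>')"

end

theory Submission
  imports Defs
begin

text \<open>A first price of 0 forces \<open>\<theta> 1 = 0\<close>. Once \<open>\<theta> 1 = 0\<close>, the offline cost is 0 only if the first
  price is 0, when the buyer pays nothing either; otherwise it is at least 1, with equality if the
  first price is 1. The competitive ratio is therefore the largest online cost that the adversary
  can force. A day \<open>j\<close> can be reached iff no earlier threshold is \<open>B\<close>, and buying there costs
  \<open>j - 1 + \<theta> j\<close>; if no threshold is \<open>B\<close>, then the buyer can be made to rent for all \<open>T\<close> days.\<close>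

section \<open>Evaluating the online and offline costs\<close>

lemma alg_cost_buy:
  assumes "j \<in> {1..T}" "p j \<le> \<theta> j" "\<forall>i\<in>{1..<j}. \<theta> i < p i"
  shows "alg_cost \<theta> T p = j - 1 + \<theta> j"
proof -
  have "buying_day \<theta> T p = j"
    unfolding buying_day_def
  proof (rule Least_equality)
    show "j \<le> i" if "i \<in> {1..T} \<and> p i \<le> \<theta> i" for i
      using that assms(3) by (meson atLeastAtMost_iff atLeastLessThan_iff leI not_le)
  qed (use assms in auto)
  moreover have "buys_within \<theta> T p"
    using assms unfolding buys_within_def by blast
  ultimately show ?thesis
    by (simp add: alg_cost_def)
qed

lemma alg_cost_rent:
  assumes "\<forall>i\<in>{1..T}. \<theta> i < p i"
  shows "alg_cost \<theta> T p = T"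
  using assms by (fastforce simp: alg_cost_def buys_within_def)

text \<open>Replaces the \<open>LEAST\<close> in \<open>buying_day\<close> by a case split that
  records that every day before the purchase was rented. This record is what later shows that the
  purchase day is reachable.\<close>

lemma alg_cost_cases:
  obtains (buy) j where "j \<in> {1..T}" "p j \<le> \<theta> j" "\<forall>i\<in>{1..<j}. \<theta> i < p i"
      "alg_cost \<theta> T p = j - 1 + \<theta> j"
  | (rent) "\<forall>i\<in>{1..T}. \<theta> i < p i" "alg_cost \<theta> T p = T"
proof (cases "\<exists>j. j \<in> {1..T} \<and> p j \<le> \<theta> j")
  case True
  then obtain j where j: "j \<in> {1..T} \<and> p j \<le> \<theta> j"
    and least: "\<And>i. i < j \<Longrightarrow> \<not> (i \<in> {1..T} \<and> p i \<le> \<theta> i)"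
    using exists_least_iff[of "\<lambda>j. j \<in> {1..T} \<and> p j \<le> \<theta> j"] by blast
  have "\<forall>i\<in>{1..<j}. \<theta> i < p i"
    using j least by (force simp: not_le)
  then show ?thesis
    using j alg_cost_buy buy by blast
next
  case False
  then have "\<forall>i\<in>{1..T}. \<theta> i < p i"
    by (meson not_le)
  then show ?thesis
    using alg_cost_rent rent by blast
qed

lemma opt_cost_le_first_price: "1 \<le> T \<Longrightarrow> opt_cost T p \<le> p 1"
  unfolding opt_cost_def
  by (rule min.coboundedI2, rule Min_le) (auto intro!: image_eqI[where x = 1])

lemma opt_cost_ge_1:
  assumes "1 \<le> T" "1 \<le> p 1"
  shows "1 \<le> opt_cost T p"
proof -
  \<comment> \<open>Day 1 costs its price; any later day is preceded by at least one day of
    rent.\<close>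
  have "1 \<le> i - 1 + p i" if "i \<in> {1..T}" for i
    using that assms by (cases "i = 1") auto
  then show ?thesis
    using assms unfolding opt_cost_def by (subst min.bounded_iff, subst Min_ge_iff) auto
qed

section \<open>The competitive ratio for a fixed horizon\<close>

text \<open>Removes the prices from the problem: what remains is one inequality per reachable
  purchase day and one for renting throughout. Day 1 is absent from the second clause because a
  purchase there at threshold 0 is free.\<close>

lemma competitive_known_iff:
  assumes "1 \<le> B" "1 \<le> T" and \<theta>: "\<theta> \<in> threshold_algs B {1..T}"
  shows "competitive_known B T \<theta> \<gamma> \<longleftrightarrow>
    \<theta> 1 = 0 \<and>
    (\<forall>j\<in>{2..T}. (\<forall>i\<in>{1..<j}. \<theta> i \<noteq> B) \<longrightarrow> real (j - 1 + \<theta> j) \<le> \<gamma>) \<and>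
    ((\<forall>i\<in>{1..T}. \<theta> i \<noteq> B) \<longrightarrow> real T \<le> \<gamma>)"
    (is "?C \<longleftrightarrow> ?zero \<and> ?buy \<and> ?rent")
proof
  assume comp: ?C
  have bound: "real (alg_cost \<theta> T p) \<le> \<gamma> * real (opt_cost T p)" if "p \<in> prices B" for p
    using comp that by (simp add: competitive_known_def competitive_def)
  have zero: ?zero
  proof -
    \<comment> \<open>The offline cost is 0 here, so every \<gamma> forces the online cost
      \<open>\<theta> 1\<close> to be 0.\<close>
    let ?p = "\<lambda>_. 0 :: nat"
    have "alg_cost \<theta> T ?p = \<theta> 1"
      using alg_cost_buy[of 1 T ?p \<theta>] assms(2) by simp
    moreover have "opt_cost T ?p = 0"
      using opt_cost_le_first_price[OF assms(2), of ?p] by simp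
    moreover have "?p \<in> prices B"
      by (simp add: prices_def)
    ultimately show ?thesis
      using bound[of ?p] by simp
  qed
  \<comment> \<open>With first price 1 the offline cost is exactly 1, so \<gamma> bounds the online
    cost directly.\<close>
  have unit: "real (alg_cost \<theta> T p) \<le> \<gamma>" if "p \<in> prices B" "p 1 = 1" for p
  proof -
    have "opt_cost T p = 1"
      using opt_cost_le_first_price[OF assms(2), of p] opt_cost_ge_1[OF assms(2), of p] that
      by simp
    then show ?thesis
      using bound[OF that(1)] by simp
  qed
  \<comment> \<open>Price 1 defeats \<open>\<theta> 1 = 0\<close>, price \<open>B\<close> defeats
    any threshold other than \<open>B\<close>, and on day \<open>n\<close> the price meets the
    threshold, so that the purchase happens there. For \<open>n = 1\<close> the first branch wins,
    so \<open>?q 1\<close> invites no purchase and serves for renting throughout.\<close>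
  let ?q = "\<lambda>n i. if i = 1 then 1 else if i = n then \<theta> n else B"
  have below: "\<theta> i < ?q n i"
    if "i \<in> {1..T}" "i \<noteq> n" "\<theta> i \<noteq> B" for n i
    using that zero \<theta> by (auto simp: threshold_algs_def le_neq_implies_less)
  have ?buy
  proof (intro ballI impI)
    fix j assume j: "j \<in> {2..T}" and reach: "\<forall>i\<in>{1..<j}. \<theta> i \<noteq> B"
    have "?q j \<in> prices B"
      using assms(1) \<theta> j by (auto simp: prices_def threshold_algs_def)
    moreover have "alg_cost \<theta> T (?q j) = j - 1 + \<theta> j"
    proof (rule alg_cost_buy)
      show "\<forall>i\<in>{1..<j}. \<theta> i < ?q j i"
      proof
        fix i assume "i \<in> {1..<j}"
        then show "\<theta> i < ?q j i"
          using j reach by (intro below) auto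
      qed
    qed (use j in auto)
    ultimately show "real (j - 1 + \<theta> j) \<le> \<gamma>"
      using unit[of "?q j"] by simp
  qed
  moreover have ?rent
  proof
    assume no: "\<forall>i\<in>{1..T}. \<theta> i \<noteq> B"
    have "?q 1 \<in> prices B"
      using assms(1) by (auto simp: prices_def)
    moreover have "\<forall>i\<in>{1..T}. \<theta> i < ?q 1 i"
      using no zero below[of _ 1] by auto
    then have "alg_cost \<theta> T (?q 1) = T"
      by (rule alg_cost_rent)
    ultimately show "real T \<le> \<gamma>"
      using unit[of "?q 1"] by simp
  qed
  ultimately show "?zero \<and> ?buy \<and> ?rent"
    using zero by blast
next
  assume R: "?zero \<and> ?buy \<and> ?rent"
  show ?C
    unfolding competitive_known_def competitive_def
  proof
    fix p assume p: "p \<in> prices B"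
    \<comment> \<open>A threshold below a legal price is below \<open>B\<close>; hence the days
      before a purchase satisfy the premises of the two clauses.\<close>
    have neq: "\<theta> i \<noteq> B" if "1 \<le> i" "\<theta> i < p i" for i
      using p that by (auto simp: prices_def)
    show "real (alg_cost \<theta> T p) \<le> \<gamma> * real (opt_cost T p)"
    proof (cases "p 1 = 0")
      case True
      have "alg_cost \<theta> T p = 0"
        using alg_cost_buy[of 1 T p \<theta>] True R assms(2) by simp
      moreover have "opt_cost T p = 0"
        using opt_cost_le_first_price[OF assms(2), of p] True by simp
      ultimately show ?thesis by simp
    next
      case False
      have le: "real (alg_cost \<theta> T p) \<le> \<gamma>"
      proof (cases rule: alg_cost_cases[of T p \<theta>])
        case (buy j)
        then have "j \<noteq> 1"
          using False R by auto
        then have "j \<in> {2..T}"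
          using buy(1) by auto
        moreover have "\<forall>i\<in>{1..<j}. \<theta> i \<noteq> B"
          using buy(3) neq by auto
        ultimately show ?thesis
          using R buy(4) by simp
      next
        case rent
        then show ?thesis
          using R neq by auto
      qed
      have "1 \<le> real (opt_cost T p)"
        using opt_cost_ge_1[OF assms(2), of p] False by simp
      \<comment> \<open>\<gamma> bounds a natural number, so it is nonnegative and does not decrease
        when multiplied by an offline cost of at least 1.\<close>
      moreover have "0 \<le> \<gamma>"
        using le by linarith
      ultimately have "\<gamma> \<le> \<gamma> * real (opt_cost T p)"
        by (simp add: mult_le_cancel_left1)
      then show ?thesis
        using le by linarith
    qed
  qed
qed

text \<open>The first occurrence of \<open>B\<close> is always reachable, and
  \<open>\<theta> 1 = 0\<close> places it on day 2 or later, where the purchase clause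
  applies.\<close>

lemma first_threshold_B:
  fixes \<theta> :: "nat \<Rightarrow> nat"
  assumes "1 \<le> B" "\<theta> 1 = 0" "\<exists>j\<in>{1..T}. \<theta> j = B"
  obtains j where "j \<in> {2..T}" "\<theta> j = B" "\<forall>i\<in>{1..<j}. \<theta> i \<noteq> B"
proof -
  obtain j where j: "j \<in> {1..T}" "\<theta> j = B"
    and least: "\<And>i. i < j \<Longrightarrow> \<not> (i \<in> {1..T} \<and> \<theta> i = B)"
    using assms(3) exists_least_iff[of "\<lambda>j. j \<in> {1..T} \<and> \<theta> j = B"] by blast
  have "j \<noteq> 1"
    using assms(1,2) j(2) by auto
  then have "j \<in> {2..T}"
    using j(1) by auto
  moreover have "\<forall>i\<in>{1..<j}. \<theta> i \<noteq> B"
    using j(1) least by force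
  ultimately show ?thesis
    using j(2) that by blast
qed

text \<open>If \<open>B\<close> occurs, a purchase at its first occurrence comes after at least one
  day of rent and costs at least \<open>B + 1\<close>. Otherwise the adversary can force
  \<open>T\<close> days of rent.\<close>

lemma competitive_known_lower_bound:
  assumes "1 \<le> B" "1 \<le> T" "\<theta> \<in> threshold_algs B {1..T}" "competitive_known B T \<theta> \<gamma>"
  shows "real (min T (B + 1)) \<le> \<gamma>"
proof -
  note R = competitive_known_iff[OF assms(1-3), THEN iffD1, OF assms(4)]
  show ?thesis
  proof (cases "\<exists>j\<in>{1..T}. \<theta> j = B")
    case True
    then obtain j where j: "j \<in> {2..T}" "\<theta> j = B" "\<forall>i\<in>{1..<j}. \<theta> i \<noteq> B"
      using first_threshold_B[OF assms(1)] R by metis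
    have "real (j - 1 + \<theta> j) \<le> \<gamma>"
      using R j(1,3) by blast
    moreover have "min T (B + 1) \<le> j - 1 + \<theta> j"
      using j(1,2) by auto
    ultimately show ?thesis
      by linarith
  next
    case False
    then have "real T \<le> \<gamma>"
      using R by blast
    then show ?thesis
      by (simp add: min_def)
  qed
qed

section \<open>Best ratios and identification of algorithms\<close>

lemma best_ratio_unique: "best_ratio A cmp \<gamma> \<Longrightarrow> best_ratio A cmp \<gamma>' \<Longrightarrow> \<gamma> = \<gamma>'"
  unfolding best_ratio_def by (blast intro: antisym)

lemma optimal_iff:
  assumes "best_ratio A cmp \<gamma>"
  shows "optimal A cmp a \<longleftrightarrow> a \<in> A \<and> cmp a \<gamma>"
proof
  assume "optimal A cmp a"
  then obtain \<gamma>' where "a \<in> A" "best_ratio A cmp \<gamma>'" "cmp a \<gamma>'"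
    unfolding optimal_def by blast
  then show "a \<in> A \<and> cmp a \<gamma>"
    using best_ratio_unique[OF assms] by simp
next
  assume "a \<in> A \<and> cmp a \<gamma>"
  then show "optimal A cmp a"
    unfolding optimal_def using assms by blast
qed

text \<open>Identified algorithms agree exactly on the reachable days, so upper bounds on thresholds
  survive identification only there. The right-hand side has the same reachability premise as
  \<open>competitive_known_iff\<close>.\<close>

lemma up_to_identification_iff:
  assumes "1 \<le> T" "\<theta> \<in> threshold_algs B {1..T}"
  shows "up_to_identification B {1..T} (\<lambda>\<eta>. \<eta> 1 = 0 \<and> (\<forall>j\<in>{2..T}. \<eta> j \<le> f j)) \<theta> \<longleftrightarrow>
    \<theta> 1 = 0 \<and> (\<forall>j\<in>{2..T}. (\<forall>i\<in>{1..<j}. \<theta> i \<noteq> B) \<longrightarrow> \<theta> j \<le> f j)"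
    (is "?U \<longleftrightarrow> ?R")
proof
  assume ?U
  then obtain \<eta> where id: "identified B {1..T} \<theta> \<eta>"
    and \<eta>: "\<eta> 1 = 0" "\<forall>j\<in>{2..T}. \<eta> j \<le> f j"
    unfolding up_to_identification_def by blast
  have eq: "\<theta> j = \<eta> j" if "j \<in> {1..T}" "\<forall>i\<in>{1..<j}. \<theta> i \<noteq> B" for j
    using id that unfolding identified_def by auto
  have "\<theta> 1 = 0"
    using eq[of 1] assms(1) \<eta>(1) by simp
  moreover have "\<theta> j \<le> f j" if "j \<in> {2..T}" "\<forall>i\<in>{1..<j}. \<theta> i \<noteq> B" for j
    using eq[of j] \<eta>(2) that by simp
  ultimately show ?R
    by blast
next
  assume R: ?R
  \<comment> \<open>Unreachable thresholds are reset to 0, which satisfies any upper bound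
    \<open>f\<close>.\<close>
  let ?\<eta> = "\<lambda>i. if \<exists>j\<in>{1..<i}. \<theta> j = B then 0 else \<theta> i"
  have "?\<eta> \<in> threshold_algs B {1..T}"
    using assms(2) by (auto simp: threshold_algs_def)
  moreover have "identified B {1..T} \<theta> ?\<eta>"
    by (auto simp: identified_def)
  moreover have "?\<eta> 1 = 0 \<and> (\<forall>j\<in>{2..T}. ?\<eta> j \<le> f j)"
    using R by auto
  ultimately show ?U
    unfolding up_to_identification_def by blast
qed

text \<open>Days 1 and 2 are always reachable when \<open>\<theta> 1 = 0\<close> differs from
  \<open>B\<close>, so identification cannot change a condition on them. The set \<open>D\<close> is
  general in order to cover both \<open>{1..T}\<close> and \<open>{1..}\<close>.\<close>

lemma up_to_identification_zero_B_iff: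
  assumes "1 \<le> B" "\<theta> \<in> threshold_algs B D" "1 \<in> D" "2 \<in> D" "0 \<notin> D"
  shows "up_to_identification B D (\<lambda>\<eta>. \<eta> 1 = 0 \<and> \<eta> 2 = B) \<theta> \<longleftrightarrow> \<theta> 1 = 0 \<and> \<theta> 2 = B"
    (is "?U \<longleftrightarrow> ?R")
proof
  assume ?U
  then obtain \<eta> where id: "identified B D \<theta> \<eta>" and \<eta>: "\<eta> 1 = 0" "\<eta> 2 = B"
    unfolding up_to_identification_def by blast
  have small: "j = 1" if "j \<in> D" "j < 2" for j
    using that assms(5) by (cases j) auto
  have "\<theta> 1 = \<eta> 1"
    using id assms(3,5) unfolding identified_def by force
  moreover from this have "\<theta> 2 = \<eta> 2"
    using id assms(1,4) \<eta>(1) small unfolding identified_def by force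
  ultimately show ?R
    using \<eta> by simp
next
  assume ?R
  moreover have "identified B D \<theta> \<theta>"
    by (simp add: identified_def)
  ultimately show ?U
    unfolding up_to_identification_def using assms(2) by blast
qed

section \<open>Best thresholds for each range of the horizon\<close>

text \<open>At ratio \<open>T\<close> the renting clause is automatic, and a purchase cost
  \<open>j - 1 + \<theta> j\<close> of at most \<open>T\<close> amounts to the bound
  \<open>T + 1 - j\<close>.\<close>

lemma competitive_known_iff_bounded_thresholds:
  assumes "1 \<le> B" "1 \<le> T" "T \<le> B + 1" and \<theta>: "\<theta> \<in> threshold_algs B {1..T}"
  shows "competitive_known B T \<theta> (real T) \<longleftrightarrow>
    up_to_identification B {1..T} (\<lambda>\<eta>. \<eta> 1 = 0 \<and> (\<forall>j\<in>{2..T}. \<eta> j \<le> T + 1 - j)) \<theta>"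
proof -
  have "real (j - 1 + \<theta> j) \<le> real T \<longleftrightarrow> \<theta> j \<le> T + 1 - j" if "j \<in> {2..T}" for j
    using that by auto
  then show ?thesis
    unfolding competitive_known_iff[OF assms(1,2) \<theta>] up_to_identification_iff[OF assms(2) \<theta>]
    by auto
qed

text \<open>Threshold \<open>B\<close> on day 2 makes all later days unreachable, so the only paid
  purchase costs \<open>1 + B\<close>. Renting throughout avoids day 2 only when
  \<open>T = 1\<close>.\<close>

lemma competitive_known_zero_B:
  assumes "1 \<le> B" "1 \<le> T" "\<theta> \<in> threshold_algs B {1..T}" "\<theta> 1 = 0" "\<theta> 2 = B"
  shows "competitive_known B T \<theta> (real (B + 1))"
proof -
  have "real (j - 1 + \<theta> j) \<le> real (B + 1)"
    if "j \<in> {2..T}" "\<forall>i\<in>{1..<j}. \<theta> i \<noteq> B" for j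
  proof -
    have "j = 2"
      using that assms(5) by (cases "j = 2") auto
    then show ?thesis
      using assms(5) by simp
  qed
  moreover have "real T \<le> real (B + 1)" if "\<forall>i\<in>{1..T}. \<theta> i \<noteq> B"
  proof -
    have "2 \<notin> {1..T}"
      using that assms(5) by blast
    then show ?thesis
      by simp
  qed
  ultimately show ?thesis
    unfolding competitive_known_iff[OF assms(1-3)] using assms(4) by blast
qed

text \<open>Renting for \<open>T > B + 1\<close> days is too expensive, so \<open>B\<close> must
  occur. Its first occurrence on day \<open>j\<close> may cost \<open>j - 1 + B\<close> \<le>
  \<open>B + 1\<close>, which leaves only day 2.\<close>

lemma competitive_known_iff_zero_B:
  assumes "1 \<le> B" "B + 1 < T" and \<theta>: "\<theta> \<in> threshold_algs B {1..T}"
  shows "competitive_known B T \<theta> (real (B + 1)) \<longleftrightarrow> \<theta> 1 = 0 \<and> \<theta> 2 = B"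
proof
  have T: "1 \<le> T"
    using assms(2) by simp
  assume "competitive_known B T \<theta> (real (B + 1))"
  note R = competitive_known_iff[OF assms(1) T \<theta>, THEN iffD1, OF this]
  have "\<exists>j\<in>{1..T}. \<theta> j = B"
  proof (rule ccontr)
    assume "\<not> ?thesis"
    then have "real T \<le> real (B + 1)"
      using R by blast
    then show False
      using assms(2) by linarith
  qed
  then obtain j where j: "j \<in> {2..T}" "\<theta> j = B" "\<forall>i\<in>{1..<j}. \<theta> i \<noteq> B"
    using first_threshold_B[OF assms(1)] R by metis
  have "real (j - 1 + \<theta> j) \<le> real (B + 1)"
    using R j(1,3) by blast
  then have "j = 2"
    using j(1,2) by auto
  then show "\<theta> 1 = 0 \<and> \<theta> 2 = B"
    using R j(2) by blast
next
  assume "\<theta> 1 = 0 \<and> \<theta> 2 = B"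
  then show "competitive_known B T \<theta> (real (B + 1))"
    using assms by (intro competitive_known_zero_B) auto
qed

text \<open>Depends on neither horizon nor prediction, so this one sequence attains ratio
  \<open>B + 1\<close> in all the settings below.\<close>

definition buy_on_day_2 :: "nat \<Rightarrow> nat \<Rightarrow> nat" where
  "buy_on_day_2 B i = (if i = 2 then B else 0)"

lemma buy_on_day_2_in_threshold_algs: "buy_on_day_2 B \<in> threshold_algs B D"
  by (simp add: threshold_algs_def buy_on_day_2_def)

lemma competitive_known_buy_on_day_2:
  "1 \<le> B \<Longrightarrow> 1 \<le> T \<Longrightarrow> competitive_known B T (buy_on_day_2 B) (real (B + 1))"
  by (rule competitive_known_zero_B)
    (simp_all add: buy_on_day_2_in_threshold_algs[of B "{1..T}", simplified] buy_on_day_2_def)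

lemma best_ratio_known:
  assumes "1 \<le> B" "B + 1 \<le> T"
  shows "best_ratio (threshold_algs B {1..T}) (competitive_known B T) (real (B + 1))"
proof -
  have T: "1 \<le> T" and min: "min T (B + 1) = B + 1"
    using assms(2) by auto
  show ?thesis
    unfolding best_ratio_def
    using competitive_known_buy_on_day_2[OF assms(1) T] buy_on_day_2_in_threshold_algs
      competitive_known_lower_bound[OF assms(1) T, unfolded min]
    by blast
qed

section \<open>Variable horizons: perfect, absent and pessimal predictions\<close>

text \<open>Without an additive constant the bound is pointwise in the inputs, so it splits over the
  horizons.\<close>

lemma competitive_perfect_iff:
  "competitive_perfect B \<Theta> \<gamma> \<longleftrightarrow> (\<forall>T\<ge>1. competitive_known B T (\<Theta> T) \<gamma>)"
  by (fastforce simp: competitive_perfect_def competitive_known_def competitive_def)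

lemma competitive_no_prediction_iff:
  "competitive_no_prediction B \<theta> \<gamma> \<longleftrightarrow> (\<forall>T\<ge>1. competitive_known B T \<theta> \<gamma>)"
  by (fastforce simp: competitive_no_prediction_def competitive_known_def competitive_def)

lemma competitive_pessimal_iff:
  "competitive_pessimal B \<Theta> \<gamma> \<longleftrightarrow> (\<forall>P\<ge>1. competitive_no_prediction B (\<Theta> P) \<gamma>)"
  by (fastforce simp: competitive_pessimal_def competitive_no_prediction_def competitive_def)

lemma threshold_algs_restrict: "\<theta> \<in> threshold_algs B {1..} \<Longrightarrow> \<theta> \<in> threshold_algs B {1..T}"
  by (simp add: threshold_algs_def)

text \<open>The single horizon \<open>B + 1\<close> suffices: it is the smallest one whose lower
  bound \<open>min T (B + 1)\<close> equals \<open>B + 1\<close>.\<close>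

lemma competitive_perfect_lower_bound:
  assumes "1 \<le> B" "\<Theta> \<in> perfect_algs B" "competitive_perfect B \<Theta> \<gamma>"
  shows "real (B + 1) \<le> \<gamma>"
proof -
  have "\<Theta> (B + 1) \<in> threshold_algs B {1..B + 1}" "competitive_known B (B + 1) (\<Theta> (B + 1)) \<gamma>"
    using assms(2,3) by (simp_all add: perfect_algs_def competitive_perfect_iff)
  then show ?thesis
    using competitive_known_lower_bound[OF assms(1), of "B + 1"] by simp
qed

lemma competitive_no_prediction_lower_bound:
  assumes "1 \<le> B" "\<theta> \<in> threshold_algs B {1..}" "competitive_no_prediction B \<theta> \<gamma>"
  shows "real (B + 1) \<le> \<gamma>"
proof (rule competitive_perfect_lower_bound)
  \<comment> \<open>An algorithm without predictions is a family that ignores its perfect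
    prediction.\<close>
  show "(\<lambda>_. \<theta>) \<in> perfect_algs B"
    using assms(2) by (simp add: perfect_algs_def threshold_algs_def)
  show "competitive_perfect B (\<lambda>_. \<theta>) \<gamma>"
    using assms(3) by (simp add: competitive_perfect_iff competitive_no_prediction_iff)
qed (fact assms(1))

lemma best_ratio_perfect:
  assumes "1 \<le> B"
  shows "best_ratio (perfect_algs B) (competitive_perfect B) (real (B + 1))"
  unfolding best_ratio_def
proof (intro conjI ballI allI impI)
  have "(\<lambda>_. buy_on_day_2 B) \<in> perfect_algs B"
    by (simp add: perfect_algs_def threshold_algs_def buy_on_day_2_def)
  then show "\<exists>\<Theta>\<in>perfect_algs B. competitive_perfect B \<Theta> (real (B + 1))"
    by (rule bexI[rotated])
      (unfold competitive_perfect_iff, blast intro: competitive_known_buy_on_day_2[OF assms])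
qed (rule competitive_perfect_lower_bound[OF assms])

lemma best_ratio_no_prediction:
  assumes "1 \<le> B"
  shows "best_ratio (threshold_algs B {1..}) (competitive_no_prediction B) (real (B + 1))"
  unfolding best_ratio_def
proof (intro conjI ballI allI impI)
  show "\<exists>\<theta>\<in>threshold_algs B {1..}. competitive_no_prediction B \<theta> (real (B + 1))"
    using competitive_known_buy_on_day_2[OF assms] buy_on_day_2_in_threshold_algs
    unfolding competitive_no_prediction_iff by blast
qed (rule competitive_no_prediction_lower_bound[OF assms])

lemma best_ratio_pessimal:
  assumes "1 \<le> B"
  shows "best_ratio (pessimal_algs B) (competitive_pessimal B) (real (B + 1))"
  unfolding best_ratio_def
proof (intro conjI ballI allI impI)
  have "(\<lambda>_. buy_on_day_2 B) \<in> pessimal_algs B"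
    by (simp add: pessimal_algs_def threshold_algs_def buy_on_day_2_def)
  then show "\<exists>\<Theta>\<in>pessimal_algs B. competitive_pessimal B \<Theta> (real (B + 1))"
    by (rule bexI[rotated])
      (unfold competitive_pessimal_iff competitive_no_prediction_iff,
        blast intro: competitive_known_buy_on_day_2[OF assms])
next
  fix \<Theta> \<gamma> assume "\<Theta> \<in> pessimal_algs B" "competitive_pessimal B \<Theta> \<gamma>"
  then show "real (B + 1) \<le> \<gamma>"
    \<comment> \<open>Even for the fixed prediction 1 the adversary chooses prices and horizon
      freely, so this member of the family is an algorithm without predictions.\<close>
    using competitive_no_prediction_lower_bound[OF assms, of "\<Theta> 1" \<gamma>]
    by (simp add: pessimal_algs_def competitive_pessimal_iff)
qed

lemma competitive_no_prediction_iff_zero_B: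
  assumes "1 \<le> B" and \<theta>: "\<theta> \<in> threshold_algs B {1..}"
  shows "competitive_no_prediction B \<theta> (real (B + 1)) \<longleftrightarrow> \<theta> 1 = 0 \<and> \<theta> 2 = B"
proof
  assume "competitive_no_prediction B \<theta> (real (B + 1))"
  \<comment> \<open>\<open>B + 2\<close> is the first horizon that is long enough to force
    \<open>B\<close> on day 2.\<close>
  then have "competitive_known B (B + 2) \<theta> (real (B + 1))"
    by (simp add: competitive_no_prediction_iff)
  then show "\<theta> 1 = 0 \<and> \<theta> 2 = B"
    using competitive_known_iff_zero_B[OF assms(1), of "B + 2"] threshold_algs_restrict[OF \<theta>]
    by simp
next
  assume "\<theta> 1 = 0 \<and> \<theta> 2 = B"
  then show "competitive_no_prediction B \<theta> (real (B + 1))"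
    using competitive_known_zero_B[OF assms(1) _ threshold_algs_restrict[OF \<theta>]]
    by (simp add: competitive_no_prediction_iff)
qed

theorem theorem2:
  fixes B :: nat
  assumes "B \<ge> 2"
  shows
    "(\<forall>T. 1 \<le> T \<and> T \<le> B \<longrightarrow>
        (\<forall>\<theta>\<in>threshold_algs B {1..T}. \<forall>\<gamma>. competitive_known B T \<theta> \<gamma> \<longrightarrow> real T \<le> \<gamma>) \<and>
        (\<forall>\<theta>\<in>threshold_algs B {1..T}.
            \<theta> 1 = 0 \<and> (\<forall>j\<in>{2..T}. \<theta> j \<le> T - j) \<longrightarrow> competitive_known B T \<theta> (real T)) \<and>
        (\<forall>\<theta>\<in>threshold_algs B {1..T}.
            competitive_known B T \<theta> (real T) \<longleftrightarrow>
            up_to_identification B {1..T}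
              (\<lambda>\<eta>. \<eta> 1 = 0 \<and> (\<forall>j\<in>{2..T}. \<eta> j \<le> T + 1 - j)) \<theta>))
     \<and>
     (\<forall>T. T = B + 1 \<longrightarrow>
        (\<forall>\<theta>\<in>threshold_algs B {1..T}.
            (optimal (threshold_algs B {1..T}) (competitive_known B T) \<theta> \<longleftrightarrow>
             up_to_identification B {1..T}
               (\<lambda>\<eta>. \<eta> 1 = 0 \<and> (\<forall>j\<in>{2..B + 1}. \<eta> j \<le> B + 2 - j)) \<theta>) \<and>
            (optimal (threshold_algs B {1..T}) (competitive_known B T) \<theta> \<longrightarrow>
             competitive_known B T \<theta> (real (B + 1)))))
     \<and>
     (\<forall>T. T > B + 1 \<longrightarrow>
        (\<forall>\<theta>\<in>threshold_algs B {1..T}.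
            (optimal (threshold_algs B {1..T}) (competitive_known B T) \<theta> \<longleftrightarrow>
             up_to_identification B {1..T} (\<lambda>\<eta>. \<eta> 1 = 0 \<and> \<eta> 2 = B) \<theta>) \<and>
            (optimal (threshold_algs B {1..T}) (competitive_known B T) \<theta> \<longrightarrow>
             competitive_known B T \<theta> (real (B + 1)))))
     \<and>
     (\<forall>\<theta>\<in>threshold_algs B {1..}.
        optimal (threshold_algs B {1..}) (competitive_no_prediction B) \<theta> \<longleftrightarrow>
        up_to_identification B {1..} (\<lambda>\<eta>. \<eta> 1 = 0 \<and> \<eta> 2 = B) \<theta>)
     \<and>
     (\<forall>\<Theta>\<in>perfect_algs B. \<forall>\<gamma>. competitive_perfect B \<Theta> \<gamma> \<longrightarrow> real (B + 1) \<le> \<gamma>)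
     \<and>
     best_ratio (perfect_algs B) (competitive_perfect B) (real (B + 1))
     \<and>
     best_ratio (threshold_algs B {1..}) (competitive_no_prediction B) (real (B + 1))
     \<and>
     best_ratio (pessimal_algs B) (competitive_pessimal B) (real (B + 1))"
proof -
  have B: "1 \<le> B"
    using assms by simp
  have small_bound: "real T \<le> \<gamma>"
    if "1 \<le> T" "T \<le> B" "\<theta> \<in> threshold_algs B {1..T}" "competitive_known B T \<theta> \<gamma>" for T \<theta> \<gamma>
    using competitive_known_lower_bound[OF B that(1,3,4)] that(2) by simp
  have small_iff: "competitive_known B T \<theta> (real T) \<longleftrightarrow>
      up_to_identification B {1..T} (\<lambda>\<eta>. \<eta> 1 = 0 \<and> (\<forall>j\<in>{2..T}. \<eta> j \<le> T + 1 - j)) \<theta>"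
    if "1 \<le> T" "T \<le> B" "\<theta> \<in> threshold_algs B {1..T}" for T \<theta>
    using competitive_known_iff_bounded_thresholds[OF B that(1) _ that(3)] that(2) by simp
  \<comment> \<open>The bounds \<open>T - j\<close> imply the exact bounds \<open>T + 1 - j\<close>.
    The converse fails for \<open>T\<close> \<ge> 2: threshold 1 on day \<open>T\<close> and 0
    elsewhere also costs at most \<open>T\<close>.\<close>
  have small_paper: "competitive_known B T \<theta> (real T)"
    if "1 \<le> T" "T \<le> B" "\<theta> \<in> threshold_algs B {1..T}" "\<theta> 1 = 0 \<and> (\<forall>j\<in>{2..T}. \<theta> j \<le> T - j)"
    for T \<theta>
    unfolding small_iff[OF that(1-3)] up_to_identification_iff[OF that(1,3)] using that(4) by force
  have large: "optimal (threshold_algs B {1..T}) (competitive_known B T) \<theta> \<longleftrightarrow>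
      competitive_known B T \<theta> (real (B + 1))"
    if "B + 1 \<le> T" "\<theta> \<in> threshold_algs B {1..T}" for T \<theta>
    using optimal_iff[OF best_ratio_known[OF B that(1)]] that(2) by simp
  \<comment> \<open>Here \<open>\<theta> 2 = B\<close> is allowed and makes all later thresholds
    unreachable, so the bounds hold only up to identification.\<close>
  have middle_iff: "competitive_known B (B + 1) \<theta> (real (B + 1)) \<longleftrightarrow>
      up_to_identification B {1..B + 1}
        (\<lambda>\<eta>. \<eta> 1 = 0 \<and> (\<forall>j\<in>{2..B + 1}. \<eta> j \<le> B + 2 - j)) \<theta>"
    if "\<theta> \<in> threshold_algs B {1..B + 1}" for \<theta>
    using competitive_known_iff_bounded_thresholds[OF B _ _ that] by simp
  have large_iff: "competitive_known B T \<theta> (real (B + 1)) \<longleftrightarrow>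
      up_to_identification B {1..T} (\<lambda>\<eta>. \<eta> 1 = 0 \<and> \<eta> 2 = B) \<theta>"
    if "B + 1 < T" "\<theta> \<in> threshold_algs B {1..T}" for T \<theta>
    using competitive_known_iff_zero_B[OF B that]
      up_to_identification_zero_B_iff[OF B that(2)] that(1) by simp
  have no_prediction_iff: "optimal (threshold_algs B {1..}) (competitive_no_prediction B) \<theta> \<longleftrightarrow>
      up_to_identification B {1..} (\<lambda>\<eta>. \<eta> 1 = 0 \<and> \<eta> 2 = B) \<theta>"
    if "\<theta> \<in> threshold_algs B {1..}" for \<theta>
    using optimal_iff[OF best_ratio_no_prediction[OF B]] that
      competitive_no_prediction_iff_zero_B[OF B that] up_to_identification_zero_B_iff[OF B that]
    by simp
  show ?thesis
  proof (intro conjI)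
    show "\<forall>T. T = B + 1 \<longrightarrow>
        (\<forall>\<theta>\<in>threshold_algs B {1..T}.
            (optimal (threshold_algs B {1..T}) (competitive_known B T) \<theta> \<longleftrightarrow>
             up_to_identification B {1..T}
               (\<lambda>\<eta>. \<eta> 1 = 0 \<and> (\<forall>j\<in>{2..B + 1}. \<eta> j \<le> B + 2 - j)) \<theta>) \<and>
            (optimal (threshold_algs B {1..T}) (competitive_known B T) \<theta> \<longrightarrow>
             competitive_known B T \<theta> (real (B + 1))))"
      using large[of "B + 1"] middle_iff by blast
    show "\<forall>T. T > B + 1 \<longrightarrow>
        (\<forall>\<theta>\<in>threshold_algs B {1..T}.
            (optimal (threshold_algs B {1..T}) (competitive_known B T) \<theta> \<longleftrightarrow>
             up_to_identification B {1..T} (\<lambda>\<eta>. \<eta> 1 = 0 \<and> \<eta> 2 = B) \<theta>) \<and>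
            (optimal (threshold_algs B {1..T}) (competitive_known B T) \<theta> \<longrightarrow>
             competitive_known B T \<theta> (real (B + 1))))"
      using large large_iff less_imp_le by blast
  qed (use small_bound small_iff small_paper no_prediction_iff competitive_perfect_lower_bound[OF B]
      best_ratio_perfect[OF B] best_ratio_no_prediction[OF B] best_ratio_pessimal[OF B] in blast)+
qed

end
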